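(* The infimum $\kappa$ of all permissible low-energy decomposition exponents satisfies $\frac13\leq\kappa\leq\frac{31}{33}$.
   Context: For a finite set $A$ of real numbers, $|A|$ denotes cardinality, and $$E_+(A)=\mathrm{card}\{(a_1,a_2,a_3,a_4)\in A^4: a_1+a_2=a_3+a_4\},$$ $$E_\times(A)=\mathrm{card}\{(a_1,a_2,a_3,a_4)\in A^4: a_1a_2=a_3a_4\}.$$ A real number $\beta$ is called a permissible low-energy decomposition exponent when, for each $\varepsilon>0$ and for all sufficiently large finite subsets $A$ of $\mathbb{R}$ (that is, all finite $A\subset\mathbb{R}$ with $|A|$ sufficiently large), there exist disjoint sets $B$ and $C$ with $A=B\cup C$ and $$\max\{E_+(B),E_\times(C)\}\leq |A|^{2+\beta+\varepsilon}.$$ *)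

theory Defs
  imports Complex_Main "HOL-Library.Extended_Real"
begin

definition additive_energy :: "real set \<Rightarrow> nat" where
  "additive_energy A =
     card {(a1, a2, a3, a4). a1 \<in> A \<and> a2 \<in> A \<and> a3 \<in> A \<and> a4 \<in> A \<and> a1 + a2 = a3 + a4}"

definition multiplicative_energy :: "real set \<Rightarrow> nat" where
  "multiplicative_energy A =
     card {(a1, a2, a3, a4). a1 \<in> A \<and> a2 \<in> A \<and> a3 \<in> A \<and> a4 \<in> A \<and> a1 * a2 = a3 * a4}"

(* The threshold N may depend on \<beta> and \<epsilon>, but not on A. *)
definition permissible_exponent :: "real \<Rightarrow> bool" where
  "permissible_exponent \<beta> \<longleftrightarrow>
     (\<forall>\<epsilon>>0. \<exists>N::nat. \<forall>A::real set. finite A \<and> card A \<ge> N \<longrightarrow>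
        (\<exists>B C. A = B \<union> C \<and> B \<inter> C = {} \<and>
           real (max (additive_energy B) (multiplicative_energy C))
             \<le> real (card A) powr (2 + \<beta> + \<epsilon>)))"

(* The infimum is taken in the extended reals, where Inf {} = \<infinity> and the infimum of a set
   unbounded below is -\<infinity>.  On type real, Inf is unspecified in these two cases. *)
definition kappa :: ereal where
  "kappa = (INF \<beta>\<in>{\<beta>. permissible_exponent \<beta>}. ereal \<beta>)"

end

theory Submission
  imports Defs "HOL-Analysis.Convex" "HOL-Analysis.Harmonic_Numbers" "HOL-Library.Disjoint_Sets"
    "HOL-Real_Asymp.Real_Asymp"
begin

text \<open>Lower bound. Take the \<open>N ^ 3\<close> numbers \<open>(2 m + 1) 2 ^ j\<close> with \<open>m < N\<^sup>2\<close> and \<open>j < N\<close>. They have only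
\<open>O (N ^ 5)\<close> products, so by Cauchy--Schwarz any part \<open>C\<close> with at least half of them has
multiplicative energy of order
at least \<open>N ^ 7\<close>. They also fall into \<open>N\<close> arithmetic progressions of length \<open>N\<^sup>2\<close>, one for each
\<open>j\<close>, so any such part \<open>B\<close> has additive energy of order at least \<open>N ^ 7\<close>. Since \<open>N ^ 7 = (N ^ 3) ^ (2 + 1/3)\<close>,
no exponent below \<open>1/3\<close> is permissible.

Upper bound. The threshold is \<open>T = n ^ (2 + 31/33)\<close> for a set \<open>A\<close> of \<open>n\<close> numbers. As long as what remains of
\<open>A\<close> has multiplicative energy above \<open>T\<close>, a piece \<open>S\<close> is moved from it into \<open>B\<close>; what is left at
the end is \<open>C\<close>. The point is to find a piece \<open>S\<close> that is large, so that there are few pieces, and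
that has few additive coincidences with all of \<open>A\<close>, so that the energy of their union is
controlled by Cauchy--Schwarz.

Such a piece comes from popular ratios. If the multiplicative energy of a set \<open>C\<close> exceeds \<open>T\<close>,
there is a set \<open>P\<close> of popular ratios and a set \<open>S\<close> of at least \<open>t = T / (4 n\<^sup>2)\<close> elements
\<open>a\<close> of \<open>C\<close> with \<open>a / p \<in> C\<close> for at least \<open>t\<close> values \<open>p \<in> P\<close>
(\<open>large_multiplicative_energy_piece\<close>). Now let \<open>X\<close> be the set of those \<open>x\<close> that are differences
\<open>s - u\<close> with \<open>s \<in> S\<close> and \<open>u \<in> U\<close> in at least \<open>k\<close> ways, for a set \<open>U\<close> of at
most \<open>n\<close> numbers. For each such way and each
\<open>p \<in> P\<close> with \<open>s / p \<in> C\<close> the point with abscissa \<open>x\<close> on the line \<open>y = (x + u) / p\<close> lies in the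
grid \<open>X \<times> C\<close>. There are thus at least \<open>card X * k * t\<close> incidences between this grid and the
\<open>card P * card U\<close> lines, and the Szemeredi--Trotter bound limits \<open>card X\<close> to a multiple of
\<open>1 / k ^ 3\<close> (\<open>few_popular_differences\<close>). Summation over \<open>k\<close> bounds the energy between \<open>S\<close> and \<open>U\<close>
(\<open>sum_squares_le_of_cubic_tail\<close>).

For a grid the Szemeredi--Trotter bound is elementary (\<open>szemeredi_trotter_grid\<close>): cut the grid
into rectangular cells. A line is monotone and so meets few cells; if it has more points than
that, some cell contains two of them. But few pairs of grid points share a cell, and a
pair determines its line.

With \<open>T = n ^ (3 - d)\<close> there are \<open>O (n ^ d)\<close> pieces, each of energy at most about
\<open>n ^ (5/2 + 5 d / 2)\<close> against \<open>A\<close>. The union has energy about \<open>n ^ (5/2 + 9 d / 2)\<close>, which stays below \<open>T\<close>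
as soon as \<open>d < 1/11\<close>; here \<open>d = 2/33\<close>.\<close>

section \<open>Collisions and energies\<close>

text \<open>Both energies count collisions: additive energy those of \<open>(a, b) \<mapsto> a - b\<close> (or of \<open>a + b\<close>) on
\<open>B \<times> B\<close>, multiplicative energy those of \<open>a / b\<close> (or of \<open>a * b\<close>). The upper bound uses
differences and quotients, the lower bound sums and products.\<close>

definition collisions :: "('a \<Rightarrow> 'b) \<Rightarrow> 'a set \<Rightarrow> ('a \<times> 'a) set" where
  "collisions f Q = {(u, v). u \<in> Q \<and> v \<in> Q \<and> f u = f v}"

lemma finite_collisions: "finite Q \<Longrightarrow> finite (collisions f Q)"
  by (rule finite_subset[of _ "Q \<times> Q"]) (auto simp: collisions_def)

lemma card_collisions:
  assumes "finite Q" "finite D" "f ` Q \<subseteq> D"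
  shows "card (collisions f Q) = (\<Sum>x\<in>D. (card {u \<in> Q. f u = x})\<^sup>2)"
proof -
  have "collisions f Q = (\<Union>x\<in>D. {u \<in> Q. f u = x} \<times> {u \<in> Q. f u = x})"
    using assms(3) by (auto simp: collisions_def)
  also have "card \<dots> = (\<Sum>x\<in>D. card ({u \<in> Q. f u = x} \<times> {u \<in> Q. f u = x}))"
    by (rule card_UN_disjoint) (use assms in auto)
  finally show ?thesis by (simp add: card_cartesian_product power2_eq_square)
qed

text \<open>Cauchy--Schwarz over the fibers: a map into a small set must collide often.\<close>

lemma card_squared_le_collisions:
  assumes "finite Q" "finite D" "f ` Q \<subseteq> D"
  shows "(real (card Q))\<^sup>2 \<le> real (card D) * real (card (collisions f Q))"
proof -
  have "(real (card Q))\<^sup>2 = (\<Sum>x\<in>D. real (card {u \<in> Q. f u = x}))\<^sup>2"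
    using sum_fun_comp[OF assms, where f = "\<lambda>_. 1 :: real"] by simp
  also have "\<dots> \<le> (\<Sum>x\<in>D. (real (card {u \<in> Q. f u = x}))\<^sup>2) * real (card D)"
    by (rule sum_squared_le_sum_of_squares)
  finally show ?thesis by (simp add: card_collisions[OF assms] mult.commute)
qed

definition diff_count :: "real set \<Rightarrow> real set \<Rightarrow> real \<Rightarrow> nat" where
  "diff_count S U x = card {u \<in> U. x + u \<in> S}"

lemma diff_count_le_right: "finite U \<Longrightarrow> diff_count S U x \<le> card U"
  unfolding diff_count_def by (rule card_mono) auto

lemma diff_count_le_left: "finite S \<Longrightarrow> diff_count S U x \<le> card S"
  unfolding diff_count_def by (rule card_inj_on_le[where f = "\<lambda>u. x + u"]) auto

lemma sum_diff_count_le: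
  assumes "finite S" "finite U" "finite D"
  shows "(\<Sum>x\<in>D. diff_count S U x) \<le> card S * card U"
proof -
  have "(\<Sum>x\<in>D. diff_count S U x) = card (SIGMA x:D. {u \<in> U. x + u \<in> S})"
    using assms by (simp add: diff_count_def)
  also have "\<dots> \<le> card (S \<times> U)"
    by (rule card_inj_on_le[where f = "\<lambda>(x, u). (x + u, u)"]) (use assms in \<open>auto simp: inj_on_def\<close>)
  finally show ?thesis by (simp add: card_cartesian_product)
qed

lemma additive_energy_eq_sum_diff_count:
  assumes "finite B" "finite D" "(\<lambda>(a, b). a - b) ` (B \<times> B) \<subseteq> D"
  shows "additive_energy B = (\<Sum>x\<in>D. (diff_count B B x)\<^sup>2)"
proof -
  let ?f = "\<lambda>(a::real, b). a - b"
  have "additive_energy B = card (collisions ?f (B \<times> B))"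
    unfolding additive_energy_def
  proof (rule bij_betw_same_card[OF bij_betw_byWitness])
    let ?g = "\<lambda>(a1::real, a2::real, a3::real, a4::real). ((a1, a3), (a4, a2))"
    let ?h = "\<lambda>((a1::real, a3::real), (a4::real, a2::real)). (a1, a2, a3, a4)"
    show "\<forall>q\<in>{(a1, a2, a3, a4). a1 \<in> B \<and> a2 \<in> B \<and> a3 \<in> B \<and> a4 \<in> B \<and> a1 + a2 = a3 + a4}.
        ?h (?g q) = q" by auto
    show "\<forall>q\<in>collisions ?f (B \<times> B). ?g (?h q) = q" by auto
  qed (auto simp: collisions_def)
  also have "\<dots> = (\<Sum>x\<in>D. (card {p \<in> B \<times> B. ?f p = x})\<^sup>2)"
    by (rule card_collisions) (use assms in auto)
  also have "\<dots> = (\<Sum>x\<in>D. (diff_count B B x)\<^sup>2)"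
  proof (rule sum.cong[OF refl])
    fix x
    have "card {p \<in> B \<times> B. ?f p = x} = diff_count B B x"
      unfolding diff_count_def
      by (rule bij_betw_same_card[OF bij_betw_byWitness[where f = snd and f' = "\<lambda>u. (x + u, u)"]]) auto
    then show "(card {p \<in> B \<times> B. ?f p = x})\<^sup>2 = (diff_count B B x)\<^sup>2" by simp
  qed
  finally show ?thesis .
qed

definition quot_count :: "real set \<Rightarrow> real \<Rightarrow> nat" where
  "quot_count C p = card {c \<in> C. p * c \<in> C}"

lemma multiplicative_energy_eq_sum_quot_count:
  assumes "finite C" "0 \<notin> C" "finite D" "(\<lambda>(a, b). a / b) ` (C \<times> C) \<subseteq> D"
  shows "multiplicative_energy C = (\<Sum>p\<in>D. (quot_count C p)\<^sup>2)"
proof -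
  let ?f = "\<lambda>(a::real, b). a / b"
  have nz: "c \<in> C \<Longrightarrow> c \<noteq> 0" for c using assms by auto
  have "multiplicative_energy C = card (collisions ?f (C \<times> C))"
    unfolding multiplicative_energy_def
  proof (rule bij_betw_same_card[OF bij_betw_byWitness])
    let ?g = "\<lambda>(a1::real, a2::real, a3::real, a4::real). ((a1, a3), (a4, a2))"
    let ?h = "\<lambda>((a1::real, a3::real), (a4::real, a2::real)). (a1, a2, a3, a4)"
    show "\<forall>q\<in>{(a1, a2, a3, a4). a1 \<in> C \<and> a2 \<in> C \<and> a3 \<in> C \<and> a4 \<in> C \<and> a1 * a2 = a3 * a4}.
        ?h (?g q) = q" by auto
    show "\<forall>q\<in>collisions ?f (C \<times> C). ?g (?h q) = q" by auto
  qed (use nz in \<open>auto simp: collisions_def frac_eq_eq mult.commute\<close>)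
  also have "\<dots> = (\<Sum>p\<in>D. (card {q \<in> C \<times> C. ?f q = p})\<^sup>2)"
    by (rule card_collisions) (use assms in auto)
  also have "\<dots> = (\<Sum>p\<in>D. (quot_count C p)\<^sup>2)"
  proof (rule sum.cong[OF refl])
    fix p
    have "card {q \<in> C \<times> C. ?f q = p} = quot_count C p"
      unfolding quot_count_def
      by (rule bij_betw_same_card[OF bij_betw_byWitness[where f = snd and f' = "\<lambda>c. (p * c, c)"]])
        (use nz in auto)
    then show "(card {q \<in> C \<times> C. ?f q = p})\<^sup>2 = (quot_count C p)\<^sup>2" by simp
  qed
  finally show ?thesis .
qed

section \<open>Incidences between lines and a grid\<close>

text \<open>In every class of \<open>g\<close> all elements but the least are second components of a pair.\<close>

lemma card_le_image_plus_pairs: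
  fixes S :: "'a::linorder set"
  assumes "finite S"
  shows "card S \<le> card (g ` S) + card {(x, x'). x \<in> S \<and> x' \<in> S \<and> x < x' \<and> g x = g x'}"
    (is "_ \<le> _ + card ?Pairs")
proof -
  define R where "R = {x \<in> S. \<forall>y\<in>S. g y = g x \<longrightarrow> x \<le> y}"
  have fP: "finite ?Pairs"
    by (rule finite_subset[of _ "S \<times> S"]) (use assms in auto)
  have "inj_on g R"
    by (auto simp: inj_on_def R_def intro: antisym)
  then have "card R = card (g ` R)" by (simp add: card_image)
  also have "\<dots> \<le> card (g ` S)"
    by (rule card_mono) (use assms in \<open>auto simp: R_def\<close>)
  finally have 1: "card R \<le> card (g ` S)" .
  have "S - R \<subseteq> snd ` ?Pairs"
  proof
    fix x assume "x \<in> S - R"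
    then obtain y where "y \<in> S" "g y = g x" "y < x" "x \<in> S" by (auto simp: R_def)
    then have "(y, x) \<in> ?Pairs" by auto
    then show "x \<in> snd ` ?Pairs" by force
  qed
  then have 2: "card (S - R) \<le> card ?Pairs" by (rule surj_card_le[OF fP])
  have "card S = card R + card (S - R)"
    using assms by (subst card_Un_disjoint[symmetric]) (auto simp: R_def intro: arg_cong[of _ _ card])
  with 1 2 show ?thesis by linarith
qed

text \<open>The elements of \<open>X\<close> are cut, in increasing order, into blocks of \<open>u\<close> consecutive ones; this is
the index of the block of \<open>x\<close>.\<close>

definition cell :: "real set \<Rightarrow> nat \<Rightarrow> real \<Rightarrow> nat" where
  "cell X u x = card {z \<in> X. z < x} div u"

lemma cell_mono: "finite X \<Longrightarrow> x \<le> y \<Longrightarrow> cell X u x \<le> cell X u y"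
  unfolding cell_def by (intro div_le_mono card_mono) auto

lemma cell_le: "finite X \<Longrightarrow> cell X u x \<le> card X div u"
  unfolding cell_def by (intro div_le_mono card_mono) auto

lemma card_div_fiber_le:
  assumes "u > 0"
  shows "card {n::nat. n div u = q} \<le> u" "finite {n::nat. n div u = q}"
proof -
  have *: "{n::nat. n div u = q} \<subseteq> {q * u..<q * u + u}"
    using assms div_mult_mod_eq[of _ u] mod_less_divisor[of u]
    by (auto simp: dividend_less_div_times add.commute)
  then show "card {n::nat. n div u = q} \<le> u" using card_mono[OF _ *] by simp
  from * show "finite {n::nat. n div u = q}" by (rule finite_subset) simp
qed

lemma card_cell_le:
  assumes "finite X" "u > 0"
  shows "card {x \<in> X. cell X u x = q} \<le> u"
proof -
  let ?rk = "\<lambda>x. card {z \<in> X. z < x}"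
  have less: "?rk x < ?rk y" if "x \<in> X" "y \<in> X" "x < y" for x y
    by (rule psubset_card_mono) (use that assms in auto)
  have "inj_on ?rk {x \<in> X. cell X u x = q}"
  proof (rule inj_onI)
    fix x y assume "x \<in> {x \<in> X. cell X u x = q}" "y \<in> {x \<in> X. cell X u x = q}" "?rk x = ?rk y"
    then show "x = y" using less[of x y] less[of y x] by (cases x y rule: linorder_cases) auto
  qed
  then have "card {x \<in> X. cell X u x = q} \<le> card {n::nat. n div u = q}"
    by (rule card_inj_on_le) (use card_div_fiber_le[OF assms(2)] in \<open>auto simp: cell_def\<close>)
  with card_div_fiber_le[OF assms(2), of q] show ?thesis by linarith
qed

text \<open>A line is strictly monotone, so along it the block index of the abscissa increases and that of the
ordinate moves in one direction. A suitable sum or difference of the two indices is therefore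
monotone and already determines the cell, and it takes few values.\<close>

lemma line_meets_few_cells:
  fixes m c :: real
  assumes "finite X" "finite Y" "m \<noteq> 0" "S \<subseteq> X"
  shows "card ((\<lambda>x. (cell X u x, cell Y v (m * x + c))) ` S) \<le> card X div u + card Y div v + 1"
    (is "card (?g ` S) \<le> ?r + ?s + 1")
proof -
  \<comment> \<open>For negative slope the second index is reversed, so that \<open>h\<close> increases along the line.\<close>
  define h where "h = (\<lambda>(a, b). if m > 0 then a + b else a + (?s - b))"
  have "inj_on h (?g ` S)"
  proof (rule inj_onI)
    fix p q assume p: "p \<in> ?g ` S" "q \<in> ?g ` S" "h p = h q"
    then obtain x y where xy: "x \<in> S" "y \<in> S" "p = ?g x" "q = ?g y" by auto
    have le: "?g x = ?g y" if "x \<in> S" "y \<in> S" "x \<le> y" "h (?g x) = h (?g y)" for x y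
    proof -
      have a: "cell X u x \<le> cell X u y" by (rule cell_mono) (use that assms in auto)
      have b: "cell Y v (m * x + c) \<le> cell Y v (m * y + c)" if "m > 0"
        by (rule cell_mono) (use that \<open>x \<le> y\<close> assms in auto)
      have c: "cell Y v (m * y + c) \<le> cell Y v (m * x + c)" if "\<not> m > 0"
        by (rule cell_mono) (use that \<open>x \<le> y\<close> assms in \<open>auto simp: mult_left_mono_neg\<close>)
      have d: "cell Y v (m * x + c) \<le> ?s" "cell Y v (m * y + c) \<le> ?s"
        using assms by (auto intro: cell_le)
      show ?thesis
        using a b c d that(4) by (cases "m > 0") (auto simp: h_def)
    qed
    show "p = q"
      using le[of x y] le[of y x] xy p(3) by (cases "x \<le> y") auto
  qed
  moreover have "h ` ?g ` S \<subseteq> {0..?r + ?s}"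
  proof
    fix k assume "k \<in> h ` ?g ` S"
    then obtain x where x: "x \<in> S" "k = h (?g x)" by auto
    have "cell X u x \<le> ?r" "cell Y v (m * x + c) \<le> ?s" using assms by (auto intro: cell_le)
    with x show "k \<in> {0..?r + ?s}" by (auto simp: h_def)
  qed
  ultimately have "card (?g ` S) \<le> card {0..?r + ?s}"
    by (rule card_inj_on_le) simp
  then show ?thesis by simp
qed

text \<open>A line \<open>y = m x + c\<close> is stored as the pair \<open>(m, c)\<close>, and an incidence by its abscissa only.\<close>

definition incidences :: "(real \<times> real) set \<Rightarrow> real set \<Rightarrow> real set \<Rightarrow> ((real \<times> real) \<times> real) set" where
  "incidences L X Y = {(l, x). l \<in> L \<and> x \<in> X \<and> fst l * x + snd l \<in> Y}"

text \<open>On each line, the incidences beyond the number of cells that it meets yield pairs of points in a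
common cell. Two points with different abscissas lie on only one line, so these pairs are distinct
for distinct lines, and each of the \<open>card X * card Y\<close> grid points has at most \<open>u * v\<close> partners.\<close>

lemma incidences_cells:
  assumes fin: "finite L" "finite X" "finite Y" and slope: "\<And>l. l \<in> L \<Longrightarrow> fst l \<noteq> 0"
    and uv: "u > 0" "v > 0"
  shows "card (incidences L X Y)
    \<le> card L * (card X div u + card Y div v + 1) + card X * card Y * (u * v)"
proof -
  let ?k = "card X div u + card Y div v + 1"
  define S where "S l = {x \<in> X. fst l * x + snd l \<in> Y}" for l
  define g where "g l x = (cell X u x, cell Y v (fst l * x + snd l))" for l x
  define Pr where "Pr l = {(x, x'). x \<in> S l \<and> x' \<in> S l \<and> x < x' \<and> g l x = g l x'}" for l
  define N where "N = (SIGMA p:X \<times> Y.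
     {x \<in> X. cell X u x = cell X u (fst p)} \<times> {y \<in> Y. cell Y v y = cell Y v (snd p)})"
  have fS: "finite (S l)" for l using fin by (auto simp: S_def)
  have fPr: "finite (Pr l)" for l
    by (rule finite_subset[of _ "S l \<times> S l"]) (use fS in \<open>auto simp: Pr_def\<close>)
  have fN: "finite N" unfolding N_def using fin by (intro finite_SigmaI) auto
  have "incidences L X Y = Sigma L S" by (auto simp: incidences_def S_def)
  then have "card (incidences L X Y) = (\<Sum>l\<in>L. card (S l))"
    using fin fS by simp
  also have "\<dots> \<le> (\<Sum>l\<in>L. ?k + card (Pr l))"
  proof (rule sum_mono)
    fix l assume l: "l \<in> L"
    have "card (S l) \<le> card (g l ` S l) + card (Pr l)"
      unfolding Pr_def by (rule card_le_image_plus_pairs[OF fS])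
    moreover have "card (g l ` S l) \<le> ?k"
      unfolding g_def by (rule line_meets_few_cells) (use fin slope l in \<open>auto simp: S_def\<close>)
    ultimately show "card (S l) \<le> ?k + card (Pr l)" by linarith
  qed
  also have "\<dots> = card L * ?k + card (Sigma L Pr)"
    using fin fPr by (simp only: sum.distrib sum_constant card_SigmaI) (simp add: algebra_simps)
  also have "card (Sigma L Pr) \<le> card N"
  proof (rule card_inj_on_le[OF _ _ fN])
    let ?f = "\<lambda>(l::real\<times>real, (x::real, x'::real)).
      ((x, fst l * x + snd l), (x', fst l * x' + snd l))"
    show "inj_on ?f (Sigma L Pr)"
    proof (rule inj_onI, clarsimp)
      fix m c x x' m' c'
      assume a: "(x, x') \<in> Pr (m, c)" and e: "m * x + c = m' * x + c'" "m * x' + c = m' * x' + c'"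
      then have "(m - m') * (x - x') = 0" by (simp add: algebra_simps)
      moreover have "x \<noteq> x'" using a by (auto simp: Pr_def)
      ultimately have "m = m'" by simp
      with e show "m = m' \<and> c = c'" by simp
    qed
    show "?f ` Sigma L Pr \<subseteq> N"
      by (auto simp: N_def Pr_def S_def g_def)
  qed
  also have "card N \<le> card X * card Y * (u * v)"
  proof -
    have "card N = (\<Sum>p\<in>X \<times> Y. card ({x \<in> X. cell X u x = cell X u (fst p)}
        \<times> {y \<in> Y. cell Y v y = cell Y v (snd p)}))"
      unfolding N_def using fin by (subst card_SigmaI) auto
    also have "\<dots> \<le> (\<Sum>p\<in>X \<times> Y. u * v)"
      unfolding card_cartesian_product
      by (intro sum_mono mult_le_mono card_cell_le) (use fin uv in auto)
    finally show ?thesis by (simp add: card_cartesian_product)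
  qed
  finally show ?thesis by simp
qed

text \<open>The cell sizes \<open>u\<close> and \<open>v\<close> are chosen so that a line meets at most \<open>3/8\<close> of \<open>I / card L\<close> cells,
where \<open>I\<close> is the number of incidences. At least half of the incidences are then accounted for by
pairs in a common cell.\<close>

lemma szemeredi_trotter_grid:
  assumes fin: "finite L" "finite X" "finite Y" and slope: "\<And>l. l \<in> L \<Longrightarrow> fst l \<noteq> 0"
    and rich: "card (incidences L X Y) \<ge> 8 * card L"
  shows "(card (incidences L X Y)) ^ 3 \<le> 162 * (card X)\<^sup>2 * (card Y)\<^sup>2 * (card L)\<^sup>2"
proof (cases "card (incidences L X Y) = 0")
  case True
  then show ?thesis by simp
next
  case False
  define I where "I = real (card (incidences L X Y))"
  define x where "x = real (card X)"
  define y where "y = real (card Y)"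
  define l where "l = real (card L)"
  have I: "I > 0" using False by (simp add: I_def)
  have "card (incidences L X Y) \<le> card (L \<times> X)"
    by (rule card_mono) (use fin in \<open>auto simp: incidences_def\<close>)
  then have Ix: "I \<le> l * x"
    by (simp add: I_def x_def l_def card_cartesian_product flip: of_nat_mult)
  have "card (incidences L X Y) \<le> card (L \<times> Y)"
  proof (rule card_inj_on_le[where f = "\<lambda>(l, x). (l, fst l * x + snd l)"])
    show "inj_on (\<lambda>(l, x). (l, fst l * x + snd l)) (incidences L X Y)"
      using slope by (force simp: inj_on_def incidences_def)
  qed (use fin in \<open>auto simp: incidences_def\<close>)
  then have Iy: "I \<le> l * y"
    by (simp add: I_def y_def l_def card_cartesian_product flip: of_nat_mult)
  have l: "l > 0" using Ix I by (cases "l = 0") (auto simp: l_def)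
  have I8: "8 * l \<le> I" using rich unfolding I_def l_def by linarith
  define u where "u = nat \<lceil>8 * x * l / I\<rceil>"
  define v where "v = nat \<lceil>8 * y * l / I\<rceil>"
  have xl: "1 \<le> x * l / I" "1 \<le> y * l / I" using Ix Iy I by (auto simp: field_simps)
  \<comment> \<open>Rounding up is harmless since the quantity rounded is at least 8.\<close>
  have ceil: "8 * a \<le> nat \<lceil>8 * a\<rceil>" "nat \<lceil>8 * a\<rceil> \<le> 9 * a" if "1 \<le> a" for a :: real
    using that by linarith+
  have u: "8 * x * l / I \<le> u" "u \<le> 9 * x * l / I"
    using ceil[OF xl(1)] by (simp_all add: u_def mult.assoc)
  have v: "8 * y * l / I \<le> v" "v \<le> 9 * y * l / I"
    using ceil[OF xl(2)] by (simp_all add: v_def mult.assoc)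
  have uv: "u > 0" "v > 0" using u v xl by (auto intro!: Nat.gr0I)
  have "real (card X div u) \<le> x / u" unfolding x_def by (rule of_nat_div_le_of_nat)
  also have "\<dots> \<le> I / (8 * l)" using u(1) uv I l by (simp add: field_simps)
  finally have r: "real (card X div u) \<le> I / (8 * l)" .
  have "real (card Y div v) \<le> y / v" unfolding y_def by (rule of_nat_div_le_of_nat)
  also have "\<dots> \<le> I / (8 * l)" using v(1) uv I l by (simp add: field_simps)
  finally have s: "real (card Y div v) \<le> I / (8 * l)" .
  have "I \<le> l * (real (card X div u) + real (card Y div v) + 1) + x * y * (real u * real v)"
    using of_nat_mono[OF incidences_cells[OF fin slope uv], where 'a = real]
    unfolding I_def x_def y_def l_def by (simp add: algebra_simps)
  also have "\<dots> \<le> l * (I / (8 * l) + I / (8 * l) + I / (8 * l)) +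
      x * y * ((9 * x * l / I) * (9 * y * l / I))"
    using r s u v I8 l
    by (intro add_mono mult_left_mono mult_mono) (auto simp: field_simps x_def y_def)
  also have "\<dots> = 3 / 8 * I + 81 * x\<^sup>2 * y\<^sup>2 * l\<^sup>2 / I\<^sup>2"
    using l I by (simp add: field_simps power2_eq_square)
  finally have "I / 2 \<le> 81 * x\<^sup>2 * y\<^sup>2 * l\<^sup>2 / I\<^sup>2" using I by linarith
  then have "I ^ 3 \<le> 162 * x\<^sup>2 * y\<^sup>2 * l\<^sup>2"
    using I by (simp add: field_simps power2_eq_square power3_eq_cube)
  then have "real ((card (incidences L X Y)) ^ 3) \<le> real (162 * (card X)\<^sup>2 * (card Y)\<^sup>2 * (card L)\<^sup>2)"
    unfolding I_def x_def y_def l_def by simp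
  then show ?thesis by (simp only: of_nat_le_iff)
qed

section \<open>From large multiplicative energy to a piece of small additive energy\<close>

text \<open>The lines are \<open>y = (x + u) / p\<close> with \<open>p \<in> P\<close> and \<open>u \<in> U\<close>. If \<open>x + u = s \<in> S\<close> then every \<open>p\<close> with
\<open>s / p \<in> C\<close> gives an incidence with the grid \<open>X \<times> C\<close>, where \<open>X\<close> is the set of popular
differences.\<close>

lemma few_popular_differences:
  fixes P C S U D :: "real set" and t :: real and k n :: nat
  assumes fin: "finite P" "finite C" "finite S" "finite U" "finite D"
    and P0: "0 \<notin> P" and S0: "0 \<notin> S" and n: "card C \<le> n" "card S \<le> n" "card U \<le> n"
    and t: "t > 0" "\<And>a. a \<in> S \<Longrightarrow> t \<le> card {p \<in> P. a / p \<in> C}" and k: "k \<ge> 1"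
  shows "real (card {x \<in> D. k \<le> diff_count S U x}) * (k * t) ^ 3 \<le> 162 * real n ^ 4 * (real (card P))\<^sup>2"
proof -
  define X where "X = {x \<in> D. k \<le> diff_count S U x}"
  define L where "L = (\<lambda>(p, u). (1 / p, u / p)) ` (P \<times> U)"
  define I where "I = card (incidences L X C)"
  have fX: "finite X" using fin by (simp add: X_def)
  have fL: "finite L" using fin by (simp add: L_def)
  show ?thesis
  proof (cases "X = {}")
    case True
    then show ?thesis by (simp flip: X_def)
  next
    case False
    have pos: "p \<in> P \<Longrightarrow> p \<noteq> 0" for p using P0 by auto
    have "inj_on (\<lambda>(p, u). (1 / p, u / p)) (P \<times> U)"
      using pos by (auto simp: inj_on_def)
    then have cL: "card L = card P * card U"
      by (simp add: L_def card_image card_cartesian_product)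
    \<comment> \<open>Each triple \<open>(x, u, p)\<close> in \<open>Z\<close> is an incidence.\<close>
    define Z where "Z = (SIGMA x:X. SIGMA u:{u \<in> U. x + u \<in> S}. {p \<in> P. (x + u) / p \<in> C})"
    have "real (card X) * (k * t) = (\<Sum>x\<in>X. real k * t)" by simp
    also have "\<dots> \<le> (\<Sum>x\<in>X. real (card (SIGMA u:{u \<in> U. x + u \<in> S}. {p \<in> P. (x + u) / p \<in> C})))"
    proof (rule sum_mono)
      fix x assume x: "x \<in> X"
      have "real k * t \<le> real (diff_count S U x) * t"
        using x t by (intro mult_right_mono) (auto simp: X_def)
      also have "\<dots> = (\<Sum>u\<in>{u \<in> U. x + u \<in> S}. t)" by (simp add: diff_count_def)
      also have "\<dots> \<le> (\<Sum>u\<in>{u \<in> U. x + u \<in> S}. real (card {p \<in> P. (x + u) / p \<in> C}))"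
        by (rule sum_mono) (use t in auto)
      also have "\<dots> = real (card (SIGMA u:{u \<in> U. x + u \<in> S}. {p \<in> P. (x + u) / p \<in> C}))"
        using fin by simp
      finally show "real k * t
          \<le> real (card (SIGMA u:{u \<in> U. x + u \<in> S}. {p \<in> P. (x + u) / p \<in> C}))" .
    qed
    also have "\<dots> = real (card Z)"
      unfolding Z_def using fin fX by (subst card_SigmaI) auto
    also have "card Z \<le> I"
      unfolding I_def
    proof (rule card_inj_on_le[where f = "\<lambda>(x, u, p). ((1 / p, u / p), x)"])
      show "inj_on (\<lambda>(x, u, p). ((1 / p, u / p), x)) Z"
        using pos by (auto simp: inj_on_def Z_def)
      show "(\<lambda>(x, u, p). ((1 / p, u / p), x)) ` Z \<subseteq> incidences L X C"
        by (auto simp: Z_def incidences_def L_def add_divide_distrib)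
      show "finite (incidences L X C)"
        by (rule finite_subset[of _ "L \<times> X"]) (use fL fX in \<open>auto simp: incidences_def\<close>)
    qed
    finally have low: "real (card X) * (k * t) \<le> real I" by simp
    have Xpos: "real (card X) > 0" using False fX by (simp add: card_gt_0_iff)
    have kt: "0 < real k * t" using k t by simp
    show ?thesis
    proof (cases "I \<ge> 8 * card L")
      case True
      have "(real (card X) * (k * t)) ^ 3 \<le> real I ^ 3"
        by (rule power_mono) (use low kt in auto)
      also have "\<dots> = real (I ^ 3)" by simp
      also have "\<dots> \<le> real (162 * (card X)\<^sup>2 * (card C)\<^sup>2 * (card L)\<^sup>2)"
        unfolding of_nat_le_iff I_def
        by (rule szemeredi_trotter_grid) (use fL fX fin True P0 in \<open>auto simp: L_def I_def\<close>)
      also have "\<dots> = 162 * (real (card X))\<^sup>2 * (real (card C))\<^sup>2 * (real (card P))\<^sup>2 * (real (card U))\<^sup>2"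
        by (simp add: cL power_mult_distrib)
      also have "\<dots> \<le> 162 * (real (card X))\<^sup>2 * (real n)\<^sup>2 * (real (card P))\<^sup>2 * (real n)\<^sup>2"
        using n by (intro mult_mono power_mono) auto
      finally have "(real (card X))\<^sup>2 * (real (card X) * (k * t) ^ 3)
          \<le> (real (card X))\<^sup>2 * (162 * real n ^ 4 * (real (card P))\<^sup>2)"
        by (simp add: power_mult_distrib power2_eq_square power3_eq_cube eval_nat_numeral mult_ac)
      then show ?thesis using Xpos unfolding X_def by (simp add: mult_le_cancel_left)
    next
      case False
      from \<open>X \<noteq> {}\<close> obtain x where x: "x \<in> X" by auto
      then have kr: "k \<le> diff_count S U x" by (simp add: X_def)
      \<comment> \<open>With few incidences per line the trivial bound suffices: \<open>k\<close> and \<open>t\<close> are themselves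
        bounded by the sizes of the sets.\<close>
      have kn: "real k \<le> n" using kr diff_count_le_right[of U S x] fin n by simp
      have "diff_count S U x > 0" using kr k by simp
      then obtain u where a: "x + u \<in> S" unfolding diff_count_def by (auto simp: card_gt_0_iff)
      then have t1: "t \<le> card {p \<in> P. (x + u) / p \<in> C}" (is "_ \<le> real (card ?R)")
        using t a by auto
      have "card ?R \<le> card P" by (rule card_mono) (use fin in auto)
      then have tP: "t \<le> card P" using t1 by linarith
      have "card ?R \<le> card C"
        by (rule card_inj_on_le[where f = "\<lambda>p. (x + u) / p"])
          (use a pos S0 fin in \<open>auto simp: inj_on_def field_simps\<close>)
      then have tn: "t \<le> n" using t1 n by linarith
      have "real (card X) * (k * t) \<le> real (8 * card L)"
        using low False by linarith
      also have "\<dots> \<le> 8 * (real (card P) * n)" using n by (simp add: cL mult_left_mono)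
      finally have few: "real (card X) * (k * t) \<le> 8 * (real (card P) * n)" .
      have ktP: "real k * t \<le> real n * card P"
        by (rule mult_mono) (use kn tP t in auto)
      have ktn: "real k * t \<le> real n * n"
        by (rule mult_mono) (use kn tn t in auto)
      have "real (card X) * (k * t) ^ 3 = (real (card X) * (k * t)) * ((k * t) * (k * t))"
        by (simp add: power3_eq_cube)
      also have "\<dots> \<le> (8 * (real (card P) * n)) * ((real n * card P) * (real n * n))"
        by (rule mult_mono[OF few mult_mono[OF ktP ktn]]) (use kt in auto)
      also have "\<dots> = 8 * real n ^ 4 * (real (card P))\<^sup>2"
        by (simp add: eval_nat_numeral)
      also have "\<dots> \<le> 162 * real n ^ 4 * (real (card P))\<^sup>2"
        by (intro mult_right_mono) auto
      finally show ?thesis unfolding X_def .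
    qed
  qed
qed

lemma harm_le_one_plus_ln:
  assumes "n \<ge> 1"
  shows "harm n \<le> 1 + ln (real n)"
  using decseqD[OF decseq_harm_diff_ln, of 0 "n - 1"] assms by (simp add: harm_def)

text \<open>With \<open>f k\<close> the number of \<open>x\<close> such that \<open>k \<le> r x\<close>, the sum of the squares is at most the sum of
\<open>2 * k * f k\<close>. The geometric mean of the bounds \<open>n\<^sup>2 / k\<close> and \<open>M / k ^ 3\<close> for \<open>f k\<close> is
\<open>n * sqrt M / k\<^sup>2\<close>, which leaves a harmonic sum.\<close>

lemma sum_squares_le_of_cubic_tail:
  fixes r :: "'a \<Rightarrow> nat" and M :: real
  assumes fin: "finite D" and n: "n \<ge> 1" "\<And>x. x \<in> D \<Longrightarrow> r x \<le> n" "(\<Sum>x\<in>D. r x) \<le> n * n"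
    and tail: "\<And>k. k \<ge> 1 \<Longrightarrow> real (card {x \<in> D. k \<le> r x}) * real k ^ 3 \<le> M"
  shows "(\<Sum>x\<in>D. (real (r x))\<^sup>2) \<le> 2 * real n * sqrt M * (1 + ln n)"
proof -
  define f where "f k = real (card {x \<in> D. k \<le> r x})" for k
  have sq: "(real m)\<^sup>2 \<le> (\<Sum>k=1..m. 2 * real k)" for m
    by (induction m) (auto simp: power2_eq_square algebra_simps)
  have "(\<Sum>x\<in>D. (real (r x))\<^sup>2) \<le> (\<Sum>x\<in>D. \<Sum>k=1..r x. 2 * real k)"
    by (intro sum_mono sq)
  also have "\<dots> = (\<Sum>x\<in>D. \<Sum>k | k \<in> {1..n} \<and> k \<le> r x. 2 * real k)"
  proof (rule sum.cong[OF refl])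
    fix x assume "x \<in> D"
    then have "{1..r x} = {k. k \<in> {1..n} \<and> k \<le> r x}" using n by force
    then show "(\<Sum>k=1..r x. 2 * real k) = (\<Sum>k | k \<in> {1..n} \<and> k \<le> r x. 2 * real k)" by simp
  qed
  also have "\<dots> = (\<Sum>k\<in>{1..n}. \<Sum>x | x \<in> D \<and> k \<le> r x. 2 * real k)"
    by (rule sum.swap_restrict) (use fin in auto)
  also have "\<dots> = (\<Sum>k=1..n. 2 * (real k * f k))"
    by (simp add: f_def mult_ac)
  also have "\<dots> \<le> (\<Sum>k=1..n. 2 * real n * sqrt M * (1 / k))"
  proof (rule sum_mono)
    fix k assume "k \<in> {1..n}"
    then have k: "k \<ge> 1" by simp
    have "card {x \<in> D. k \<le> r x} * k = (\<Sum>x | x \<in> D \<and> k \<le> r x. k)" by simp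
    also have "\<dots> \<le> (\<Sum>x | x \<in> D \<and> k \<le> r x. r x)" by (rule sum_mono) auto
    also have "\<dots> \<le> (\<Sum>x\<in>D. r x)" by (rule sum_mono2) (use fin in auto)
    also have "\<dots> \<le> n * n" by (rule n)
    finally have 1: "f k * k \<le> real n * real n" unfolding f_def by (simp flip: of_nat_mult)
    have 2: "f k * real k ^ 3 \<le> M" using tail[OF k] by (simp add: f_def)
    have f0: "f k \<ge> 0" by (simp add: f_def)
    have M0: "M \<ge> 0" by (rule order_trans[OF _ 2]) (use f0 in auto)
    have "(f k * (real k)\<^sup>2)\<^sup>2 = (f k * k) * (f k * real k ^ 3)"
      by (simp add: eval_nat_numeral mult_ac)
    also have "\<dots> \<le> (real n * real n) * M"
      by (rule mult_mono[OF 1 2]) (use f0 in auto)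
    also have "\<dots> = (n * sqrt M)\<^sup>2" using M0 by (simp add: power_mult_distrib power2_eq_square)
    finally have "f k * (real k)\<^sup>2 \<le> n * sqrt M"
      by (rule power2_le_imp_le) (use M0 in auto)
    then show "2 * (real k * f k) \<le> 2 * real n * sqrt M * (1 / k)"
      using k by (simp add: field_simps power2_eq_square)
  qed
  also have "\<dots> = 2 * real n * sqrt M * harm n"
    by (simp only: sum_distrib_left harm_def divide_inverse mult_1)
  also have "\<dots> \<le> 2 * real n * sqrt M * (1 + ln n)"
  proof (rule mult_left_mono[OF harm_le_one_plus_ln[OF n(1)]])
    have "0 \<le> M" by (rule order_trans[OF _ tail[of 1]]) auto
    then show "0 \<le> 2 * real n * sqrt M" by simp
  qed
  finally show ?thesis .
qed

text \<open>The value of \<open>sum_squares_le_of_cubic_tail\<close> for the \<open>M\<close> that comes from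
\<open>few_popular_differences\<close> with \<open>card P \<le> 2 * n ^ 4 / T\<close> and \<open>t = T / (4 * n\<^sup>2)\<close>.\<close>

definition energy_bound :: "real \<Rightarrow> real \<Rightarrow> real" where
  "energy_bound n T = 2 * n * sqrt (41472 * n ^ 18 / T ^ 5) * (1 + ln n)"

text \<open>The sum over all \<open>x\<close> is the number of solutions of \<open>s - u = s' - u'\<close> with \<open>s, s' \<in> S\<close> and
\<open>u, u' \<in> U\<close>. The bound is required for every \<open>U\<close> because, when the pieces are put together, each is
compared with their union, which is not known when the piece is chosen.\<close>

definition low_energy_piece :: "nat \<Rightarrow> real \<Rightarrow> real set \<Rightarrow> bool" where
  "low_energy_piece n W S \<longleftrightarrow>
     (\<forall>U D. finite U \<and> card U \<le> n \<and> finite D \<longrightarrow> (\<Sum>x\<in>D. (real (diff_count S U x))\<^sup>2) \<le> W)"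

text \<open>Ratios with fewer than \<open>T / (2 * n\<^sup>2)\<close> representations contribute at most half of the energy. The
other ratios form \<open>P\<close>; they have at least \<open>T / (2 * n)\<close> representations in all, so
many elements of \<open>C\<close> take part in at least half the average number of them.\<close>

lemma large_multiplicative_energy_piece:
  fixes C :: "real set" and T :: real
  assumes fin: "finite C" and C0: "0 \<notin> C" and n: "card C \<le> n"
    and T: "T > 0" "T < multiplicative_energy C"
  shows "\<exists>S\<subseteq>C. T / (4 * (real n)\<^sup>2) \<le> card S \<and> low_energy_piece n (energy_bound n T) S"
proof -
  define Q where "Q = (\<lambda>(a, b). a / b) ` (C \<times> C)"
  define q where "q = quot_count C"
  define \<tau> where "\<tau> = T / (2 * (real n)\<^sup>2)"
  define t where "t = T / (4 * (real n)\<^sup>2)"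
  define P where "P = {p \<in> Q. \<tau> \<le> q p}"
  define w where "w a = card {p \<in> P. a / p \<in> C}" for a
  define S where "S = {a \<in> C. t \<le> w a}"
  have nz: "c \<in> C \<Longrightarrow> c \<noteq> 0" for c using C0 by auto
  have fQ: "finite Q" and fP: "finite P" using fin by (auto simp: Q_def P_def)
  have fS: "finite S" using fin by (auto simp: S_def)
  have P0: "p \<in> P \<Longrightarrow> p \<noteq> 0" for p using nz by (auto simp: P_def Q_def)
  have E: "real (multiplicative_energy C) = (\<Sum>p\<in>Q. (real (q p))\<^sup>2)"
    using multiplicative_energy_eq_sum_quot_count[OF fin C0 fQ] by (simp add: Q_def q_def)
  have "C \<noteq> {}" using T by (auto simp: multiplicative_energy_def)
  then have n1: "n \<ge> 1" using n fin by (metis One_nat_def Suc_leI card_gt_0_iff le_trans)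
  have qn: "q p \<le> n" for p
    unfolding q_def quot_count_def using fin n by (intro order_trans[OF card_mono n]) auto
  have "(\<Sum>p\<in>Q. q p) = card (SIGMA p:Q. {c \<in> C. p * c \<in> C})"
    using fin fQ by (simp add: q_def quot_count_def)
  also have "\<dots> \<le> card (C \<times> C)"
    by (rule card_inj_on_le[where f = "\<lambda>(p, c). (p * c, c)"])
      (use fin nz in \<open>auto simp: inj_on_def\<close>)
  also have "\<dots> \<le> n * n" using n by (simp add: card_cartesian_product mult_le_mono)
  finally have "real (\<Sum>p\<in>Q. q p) \<le> real (n * n)" by (simp only: of_nat_le_iff)
  then have sumQ: "(\<Sum>p\<in>Q. real (q p)) \<le> (real n)\<^sup>2" by (simp add: power2_eq_square)
  have sumP_le: "(\<Sum>p\<in>P. real (q p)) \<le> (real n)\<^sup>2"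
    by (rule order_trans[OF sum_mono2 sumQ]) (use fQ in \<open>auto simp: P_def\<close>)
  have "(\<Sum>p\<in>Q - P. (real (q p))\<^sup>2) \<le> (\<Sum>p\<in>Q - P. \<tau> * real (q p))"
    unfolding power2_eq_square by (intro sum_mono mult_right_mono) (auto simp: P_def)
  also have "\<dots> \<le> (\<Sum>p\<in>Q. \<tau> * real (q p))"
    by (rule sum_mono2) (use fQ T in \<open>auto simp: \<tau>_def\<close>)
  also have "\<dots> = \<tau> * (\<Sum>p\<in>Q. real (q p))" by (simp only: sum_distrib_left)
  also have "\<dots> \<le> \<tau> * (real n)\<^sup>2" by (rule mult_left_mono[OF sumQ]) (use T in \<open>simp add: \<tau>_def\<close>)
  also have "\<dots> = T / 2" using n1 by (simp add: \<tau>_def)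
  finally have unpopular: "(\<Sum>p\<in>Q - P. (real (q p))\<^sup>2) \<le> T / 2" .
  have "(\<Sum>p\<in>Q. (real (q p))\<^sup>2) = (\<Sum>p\<in>Q - P. (real (q p))\<^sup>2) + (\<Sum>p\<in>P. (real (q p))\<^sup>2)"
    by (rule sum.subset_diff) (use fQ in \<open>auto simp: P_def\<close>)
  then have "T / 2 \<le> (\<Sum>p\<in>P. (real (q p))\<^sup>2)" using unpopular E T by linarith
  also have "\<dots> \<le> (\<Sum>p\<in>P. real n * real (q p))"
    unfolding power2_eq_square by (intro sum_mono mult_right_mono) (use qn in auto)
  also have "\<dots> = real n * (\<Sum>p\<in>P. real (q p))" by (simp only: sum_distrib_left)
  finally have sumP: "T / (2 * n) \<le> (\<Sum>p\<in>P. real (q p))" using n1 by (simp add: field_simps)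
  have "card P * \<tau> = (\<Sum>p\<in>P. \<tau>)" by simp
  also have "\<dots> \<le> (\<Sum>p\<in>P. real (q p))" by (rule sum_mono) (auto simp: P_def)
  finally have "card P * \<tau> \<le> (real n)\<^sup>2" using sumP_le by linarith
  then have cP: "card P \<le> 2 * real n ^ 4 / T"
    using T n1 by (simp add: \<tau>_def field_simps eval_nat_numeral)
  have "(\<Sum>a\<in>C. w a) = (\<Sum>a\<in>C. \<Sum>p | p \<in> P \<and> a / p \<in> C. 1)" by (simp add: w_def)
  also have "\<dots> = (\<Sum>p\<in>P. \<Sum>a | a \<in> C \<and> a / p \<in> C. 1)"
    by (rule sum.swap_restrict) (use fin fP in auto)
  also have "\<dots> = (\<Sum>p\<in>P. q p)"
  proof (rule sum.cong[OF refl])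
    fix p assume p: "p \<in> P"
    have "card {a \<in> C. a / p \<in> C} = card {c \<in> C. p * c \<in> C}"
      by (rule bij_betw_same_card[OF bij_betw_byWitness[where f = "\<lambda>a. a / p" and f' = "\<lambda>c. p * c"]])
        (use P0[OF p] in auto)
    then show "(\<Sum>a | a \<in> C \<and> a / p \<in> C. 1) = q p" by (simp add: q_def quot_count_def)
  qed
  finally have "real (\<Sum>a\<in>C. w a) = real (\<Sum>p\<in>P. q p)" by (simp only:)
  then have sumw: "(\<Sum>a\<in>C. real (w a)) = (\<Sum>p\<in>P. real (q p))" by simp
  have wn: "w a \<le> n" if "a \<in> C" for a
  proof -
    have "w a \<le> card C" unfolding w_def
      by (rule card_inj_on_le[where f = "\<lambda>p. a / p"])
        (use nz[OF that] P0 fin in \<open>auto simp: inj_on_def field_simps\<close>)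
    with n show ?thesis by simp
  qed
  have "T / (2 * n) \<le> (\<Sum>a\<in>C. real (w a))" using sumP sumw by simp
  also have "\<dots> = (\<Sum>a\<in>C - S. real (w a)) + (\<Sum>a\<in>S. real (w a))"
    by (rule sum.subset_diff) (use fin in \<open>auto simp: S_def\<close>)
  also have "(\<Sum>a\<in>C - S. real (w a)) \<le> (\<Sum>a\<in>C - S. t)"
    by (rule sum_mono) (auto simp: S_def)
  also have "(\<Sum>a\<in>C - S. t) \<le> n * t"
  proof -
    have "card (C - S) \<le> n" using card_mono[of C "C - S"] fin n by auto
    then show ?thesis using T by (simp add: t_def divide_right_mono mult_right_mono)
  qed
  also have "(\<Sum>a\<in>S. real (w a)) \<le> (\<Sum>a\<in>S. real n)"
    by (rule sum_mono) (use wn in \<open>auto simp: S_def\<close>)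
  also have "real n * t = T / (4 * n)" using n1 by (simp add: t_def field_simps power2_eq_square)
  finally have "T / (4 * n) \<le> card S * n" by (simp add: field_simps)
  then have cS: "t \<le> card S" using n1 by (simp add: t_def field_simps power2_eq_square)
  have t: "t > 0" using T n1 by (simp add: t_def)
  have cSn: "card S \<le> n" using card_mono[of C S] fin n by (auto simp: S_def)
  have "low_energy_piece n (energy_bound n T) S"
    unfolding low_energy_piece_def energy_bound_def
  proof (intro allI impI, elim conjE)
    fix U D :: "real set"
    assume U: "finite U" "card U \<le> n" and D: "finite D"
    show "(\<Sum>x\<in>D. (real (diff_count S U x))\<^sup>2) \<le> 2 * real n * sqrt (41472 * real n ^ 18 / T ^ 5) * (1 + ln (real n))"
    proof (rule sum_squares_le_of_cubic_tail[OF D n1])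
      show "diff_count S U x \<le> n" for x using diff_count_le_right[OF U(1), of S x] U by simp
      show "(\<Sum>x\<in>D. diff_count S U x) \<le> n * n"
        by (rule order_trans[OF sum_diff_count_le[OF fS U(1) D] mult_le_mono[OF cSn U(2)]])
      fix k :: nat assume k: "k \<ge> 1"
      have "real (card {x \<in> D. k \<le> diff_count S U x}) * (k * t) ^ 3 \<le> 162 * real n ^ 4 * (real (card P))\<^sup>2"
        by (rule few_popular_differences[OF fP fin fS U(1) D _ _ n cSn U(2) t _ k])
          (use P0 C0 in \<open>auto simp: S_def w_def\<close>)
      also have "\<dots> \<le> 162 * real n ^ 4 * (2 * real n ^ 4 / T)\<^sup>2"
        by (intro mult_left_mono power_mono cP) auto
      finally have "real (card {x \<in> D. k \<le> diff_count S U x}) * real k ^ 3 \<le> 162 * real n ^ 4 * (2 * real n ^ 4 / T)\<^sup>2 / t ^ 3"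
        using t by (subst pos_le_divide_eq) (simp_all add: power_mult_distrib mult_ac)
      also have "\<dots> = 41472 * real n ^ 18 / T ^ 5"
        using T n1 by (simp add: t_def field_simps eval_nat_numeral)
      finally show "real (card {x \<in> D. k \<le> diff_count S U x}) * real k ^ 3 \<le> 41472 * real n ^ 18 / T ^ 5" .
    qed
  qed
  with cS show ?thesis unfolding t_def by (intro exI[of _ S]) (auto simp: S_def)
qed

section \<open>Peeling off the pieces\<close>

text \<open>The greedy process, stated for an arbitrary notion of piece and of a remainder at which
to stop.\<close>

lemma peel_off_pieces:
  assumes "finite C" and "\<And>C'. C' \<subseteq> C \<Longrightarrow> \<not> good C' \<Longrightarrow> \<exists>S\<subseteq>C'. S \<noteq> {} \<and> piece S"
  shows "\<exists>F D. C = \<Union>F \<union> D \<and> \<Union>F \<inter> D = {} \<and> disjoint F \<and> (\<forall>S\<in>F. piece S) \<and> good D"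
  using assms
proof (induction C rule: finite_psubset_induct)
  case (psubset C)
  show ?case
  proof (cases "good C")
    case True
    then show ?thesis by (intro exI[of _ "{}"] exI[of _ C]) auto
  next
    case False
    then obtain S where S: "S \<subseteq> C" "S \<noteq> {}" "piece S" using psubset.prems by blast
    then have "\<exists>F D. C - S = \<Union>F \<union> D \<and> \<Union>F \<inter> D = {} \<and> disjoint F \<and> (\<forall>S\<in>F. piece S) \<and> good D"
      by (intro psubset.IH psubset.prems) auto
    then obtain F D where FD: "C - S = \<Union>F \<union> D" "\<Union>F \<inter> D = {}" "disjoint F"
      "\<forall>S\<in>F. piece S" "good D" by (elim exE conjE) (rule that)
    have "disjoint (insert S F)"
      unfolding pairwise_insert using FD by (auto simp: disjnt_def)
    then show ?thesis
      using FD S by (intro exI[of _ "insert S F"] exI[of _ D]) auto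
  qed
qed

text \<open>The number of representations of \<open>x\<close> as a difference of elements of \<open>B\<close> is a sum over the pieces;
Cauchy--Schwarz squares it at the cost of a factor \<open>card F\<close>.\<close>

lemma additive_energy_Union_le:
  assumes "finite B" "B = \<Union>F" "finite F" "disjoint F" "card B \<le> n"
    and piece: "\<And>S. S \<in> F \<Longrightarrow> low_energy_piece n W S"
  shows "additive_energy B \<le> (real (card F))\<^sup>2 * W"
proof -
  define D where "D = (\<lambda>(a, b). a - b) ` (B \<times> B)"
  have fD: "finite D" using assms by (simp add: D_def)
  have split: "diff_count B B x = (\<Sum>S\<in>F. diff_count S B x)" for x
  proof -
    have "{u \<in> B. x + u \<in> B} = (\<Union>S\<in>F. {u \<in> B. x + u \<in> S})" using assms by auto
    also have "card \<dots> = (\<Sum>S\<in>F. card {u \<in> B. x + u \<in> S})"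
    proof (rule card_UN_disjoint[OF assms(3)])
      show "\<forall>S\<in>F. finite {u \<in> B. x + u \<in> S}" using assms(1) by simp
      show "\<forall>S\<in>F. \<forall>S'\<in>F. S \<noteq> S' \<longrightarrow> {u \<in> B. x + u \<in> S} \<inter> {u \<in> B. x + u \<in> S'} = {}"
        using assms(4) by (fastforce simp: pairwise_def disjnt_iff)
    qed
    finally show ?thesis by (simp add: diff_count_def)
  qed
  have "real (additive_energy B) = (\<Sum>x\<in>D. (real (diff_count B B x))\<^sup>2)"
    using additive_energy_eq_sum_diff_count[OF assms(1) fD] by (simp add: D_def)
  also have "\<dots> \<le> (\<Sum>x\<in>D. (\<Sum>S\<in>F. (real (diff_count S B x))\<^sup>2) * card F)"
    unfolding split of_nat_sum by (intro sum_mono sum_squared_le_sum_of_squares)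
  also have "\<dots> = card F * (\<Sum>S\<in>F. \<Sum>x\<in>D. (real (diff_count S B x))\<^sup>2)"
    unfolding sum_distrib_right[symmetric] by (subst sum.swap) (simp add: mult.commute)
  also have "\<dots> \<le> card F * (\<Sum>S\<in>F. W)"
    using piece assms(1,5) fD
    by (intro mult_left_mono sum_mono) (auto simp: low_energy_piece_def)
  finally show ?thesis by (simp add: power2_eq_square)
qed

text \<open>Each piece has at least \<open>T / (4 * n\<^sup>2)\<close> elements and the pieces are disjoint, so there are at most
\<open>4 * n ^ 3 / T\<close> of them. The number \<open>0\<close>, which has no place among ratios, becomes one further piece
of \<open>B\<close>; this explains the summand \<open>1\<close>. The hypothesis
\<open>n \<le> energy_bound n T\<close> is what makes this piece conform.\<close>

lemma low_energy_decomposition: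
  fixes A :: "real set" and T :: real
  assumes fin: "finite A" and n: "card A = n" "n \<ge> 1" and T: "T > 0"
    and W: "n \<le> energy_bound n T"
  shows "\<exists>B C. A = B \<union> C \<and> B \<inter> C = {} \<and> multiplicative_energy C \<le> T
     \<and> additive_energy B \<le> (4 * real n ^ 3 / T + 1)\<^sup>2 * energy_bound n T"
proof -
  let ?W = "energy_bound n T"
  define piece where "piece S \<longleftrightarrow> T / (4 * (real n)\<^sup>2) \<le> card S \<and> low_energy_piece n ?W S" for S
  have "\<exists>F D. A - {0} = \<Union>F \<union> D \<and> \<Union>F \<inter> D = {} \<and> disjoint F \<and> (\<forall>S\<in>F. piece S)
      \<and> real (multiplicative_energy D) \<le> T"
  proof (rule peel_off_pieces[where piece = piece and good = "\<lambda>C. real (multiplicative_energy C) \<le> T"])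
    fix C assume C: "C \<subseteq> A - {0}" "\<not> real (multiplicative_energy C) \<le> T"
    then have "finite C" "0 \<notin> C" using fin finite_subset by auto
    moreover have "card C \<le> n" using card_mono[of A C] C fin n by auto
    ultimately obtain S where S: "S \<subseteq> C" "piece S"
      using large_multiplicative_energy_piece[of C n T] C T unfolding piece_def by auto
    have "T / (4 * (real n)\<^sup>2) > 0" using T n by simp
    with S have "real (card S) > 0" unfolding piece_def by linarith
    then have "S \<noteq> {}" by auto
    with S show "\<exists>S\<subseteq>C. S \<noteq> {} \<and> piece S" by (intro exI[of _ S] conjI)
  qed (use fin in auto)
  then obtain F D where FD: "A - {0} = \<Union>F \<union> D" "\<Union>F \<inter> D = {}" "disjoint F"
      "\<forall>S\<in>F. piece S" "real (multiplicative_energy D) \<le> T"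
    by (elim exE conjE) (rule that)
  define G where "G = insert (A \<inter> {0}) F"
  have sub: "\<Union>F \<subseteq> A" using FD by auto
  have fF: "finite F" using finite_UnionD[of F] finite_subset[OF sub fin] by auto
  have fS: "finite S" if "S \<in> F" for S using that sub fin finite_subset by (metis Union_upper)
  have "card F * (T / (4 * (real n)\<^sup>2)) = (\<Sum>S\<in>F. T / (4 * (real n)\<^sup>2))" by simp
  also have "\<dots> \<le> (\<Sum>S\<in>F. real (card S))" using FD by (intro sum_mono) (auto simp: piece_def)
  also have "\<dots> = real (card (\<Union>F))"
    using FD(3) fS by (subst card_Union_disjoint) auto
  also have "\<dots> \<le> n" using card_mono[OF fin sub] n by simp
  finally have cF: "card F \<le> 4 * real n ^ 3 / T"
    using T n by (simp add: field_simps eval_nat_numeral)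
  have cG: "card G \<le> 4 * real n ^ 3 / T + 1"
    using cF card_insert_le_m1[of "Suc (card F)" F "A \<inter> {0}"] unfolding G_def by simp
  have "low_energy_piece n ?W (A \<inter> {0})"
    unfolding low_energy_piece_def
  proof (intro allI impI, elim conjE)
    fix U E :: "real set" assume U: "finite U" "card U \<le> n" "finite E"
    have r1: "diff_count (A \<inter> {0}) U x \<le> 1" for x
      using diff_count_le_left[of "A \<inter> {0}" U x] card_mono[of "{0}" "A \<inter> {0}"] fin by simp
    have "(\<Sum>x\<in>E. (real (diff_count (A \<inter> {0}) U x))\<^sup>2) \<le> (\<Sum>x\<in>E. real (diff_count (A \<inter> {0}) U x))"
      using r1 by (intro sum_mono) (auto simp: power2_eq_square mult_left_le)
    also have "\<dots> \<le> real (card (A \<inter> {0}) * card U)"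
      using sum_diff_count_le[of "A \<inter> {0}" U E] fin U unfolding of_nat_sum[symmetric] of_nat_le_iff by auto
    also have "\<dots> \<le> real (1 * n)"
      unfolding of_nat_le_iff using card_mono[of "{0}" "A \<inter> {0}"] U by (intro mult_le_mono) auto
    finally show "(\<Sum>x\<in>E. (real (diff_count (A \<inter> {0}) U x))\<^sup>2) \<le> ?W" using W by simp
  qed
  then have pieces: "\<And>S. S \<in> G \<Longrightarrow> low_energy_piece n ?W S"
    using FD unfolding G_def piece_def by auto
  have disj: "disjoint G"
    unfolding G_def pairwise_insert using FD by (auto simp: disjnt_def)
  have "additive_energy (\<Union>G) \<le> (real (card G))\<^sup>2 * ?W"
  proof (rule additive_energy_Union_le[OF _ refl _ disj _ pieces])
    have "\<Union>G \<subseteq> A" using sub by (auto simp: G_def)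
    then show "finite (\<Union>G)" "card (\<Union>G) \<le> n"
      using fin finite_subset card_mono[of A "\<Union>G"] n by auto
    show "finite G" using fF by (simp add: G_def)
  qed
  also have "\<dots> \<le> (4 * real n ^ 3 / T + 1)\<^sup>2 * ?W"
    using cG W by (intro mult_right_mono power_mono) auto
  finally have "additive_energy (\<Union>G) \<le> (4 * real n ^ 3 / T + 1)\<^sup>2 * ?W" .
  moreover have "A = \<Union>G \<union> D" "\<Union>G \<inter> D = {}" using FD unfolding G_def by auto
  ultimately show ?thesis using FD(5) by blast
qed

lemma permissible_exponent_31_33: "permissible_exponent (31 / 33)"
proof -
  let ?T = "\<lambda>n::nat. real n powr (2 + 31 / 33)"
  have "eventually (\<lambda>n::nat. real n \<le> energy_bound n (?T n)) at_top"
    unfolding energy_bound_def by real_asymp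
  moreover have "eventually (\<lambda>n::nat. (4 * real n ^ 3 / ?T n + 1)\<^sup>2 * energy_bound n (?T n) \<le> ?T n) at_top"
    unfolding energy_bound_def by real_asymp
  ultimately have "eventually (\<lambda>n. n \<ge> 1 \<and> n \<le> energy_bound n (?T n)
      \<and> (4 * real n ^ 3 / ?T n + 1)\<^sup>2 * energy_bound n (?T n) \<le> ?T n) at_top"
    using eventually_ge_at_top[of "1::nat"] by eventually_elim auto
  then obtain N where N: "\<And>n. n \<ge> N \<Longrightarrow> n \<ge> 1 \<and> n \<le> energy_bound n (?T n)
      \<and> (4 * real n ^ 3 / ?T n + 1)\<^sup>2 * energy_bound n (?T n) \<le> ?T n"
    unfolding eventually_at_top_linorder by blast
  show ?thesis
    unfolding permissible_exponent_def
  proof (intro allI impI exI[of _ N], elim conjE)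
    fix \<epsilon> :: real and A :: "real set"
    assume \<epsilon>: "\<epsilon> > 0" and A: "finite A" "N \<le> card A"
    let ?n = "card A"
    note N' = N[OF A(2)]
    then have "?T ?n > 0" by simp
    then obtain B C where BC: "A = B \<union> C" "B \<inter> C = {}" "multiplicative_energy C \<le> ?T ?n"
      "additive_energy B \<le> (4 * real ?n ^ 3 / ?T ?n + 1)\<^sup>2 * energy_bound ?n (?T ?n)"
      using low_energy_decomposition[OF A(1) refl, of "?T ?n"] N' by blast
    have "real (max (additive_energy B) (multiplicative_energy C)) \<le> ?T ?n"
      using BC N' by (simp add: max_def)
    also have "?T ?n \<le> real ?n powr (2 + 31 / 33 + \<epsilon>)"
      using N' \<epsilon> by (intro powr_mono) auto
    finally show "\<exists>B C. A = B \<union> C \<and> B \<inter> C = {} \<and>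
        real (max (additive_energy B) (multiplicative_energy C)) \<le> real ?n powr (2 + 31 / 33 + \<epsilon>)"
      using BC by blast
  qed
qed

section \<open>A set with no good decomposition\<close>

lemma multiplicative_energy_lower:
  assumes "finite C" "finite D" "\<And>a b. a \<in> C \<Longrightarrow> b \<in> C \<Longrightarrow> a * b \<in> D"
  shows "real (card C) ^ 4 \<le> real (card D) * real (multiplicative_energy C)"
proof -
  let ?f = "\<lambda>(a::real, b). a * b"
  have "collisions ?f (C \<times> C) = (\<lambda>(a1, a2, a3, a4). ((a1, a2), (a3, a4))) `
      {(a1, a2, a3, a4). a1 \<in> C \<and> a2 \<in> C \<and> a3 \<in> C \<and> a4 \<in> C \<and> a1 * a2 = a3 * a4}"
    by (auto simp: collisions_def image_iff)
  then have "card (collisions ?f (C \<times> C)) = multiplicative_energy C"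
    unfolding multiplicative_energy_def by (simp add: card_image inj_on_def)
  moreover have "(real (card (C \<times> C)))\<^sup>2 \<le> real (card D) * real (card (collisions ?f (C \<times> C)))"
    by (rule card_squared_le_collisions) (use assms in auto)
  ultimately show ?thesis by (simp add: card_cartesian_product eval_nat_numeral mult_ac)
qed

text \<open>Two applications of Cauchy--Schwarz: first many pairs of \<open>B\<close> lie in a common class of \<open>v\<close>, then these
pairs have many coincidences among their few sums.\<close>

lemma additive_energy_lower:
  assumes "finite B" "finite V" "v ` B \<subseteq> V" "finite D"
    and sums: "\<And>a b. a \<in> B \<Longrightarrow> b \<in> B \<Longrightarrow> v a = v b \<Longrightarrow> a + b \<in> D"
  shows "real (card B) ^ 4 \<le> (real (card V))\<^sup>2 * (real (card D) * real (additive_energy B))"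
proof -
  let ?f = "\<lambda>(a::real, b). a + b"
  define Q where "Q = collisions v B"
  let ?A = "{(a1, a2, a3, a4). a1 \<in> B \<and> a2 \<in> B \<and> a3 \<in> B \<and> a4 \<in> B \<and> a1 + a2 = a3 + a4}"
  have fQ: "finite Q" using assms by (simp add: Q_def finite_collisions)
  have "finite ?A"
    by (rule finite_subset[of _ "B \<times> B \<times> B \<times> B"]) (use assms in auto)
  then have le: "card (collisions ?f Q) \<le> additive_energy B"
    unfolding additive_energy_def
    by (intro card_inj_on_le[where f = "\<lambda>((a1, a2), (a3, a4)). (a1, a2, a3, a4)"])
      (auto simp: collisions_def Q_def inj_on_def)
  have "(real (card B))\<^sup>2 \<le> real (card V) * real (card Q)"
    unfolding Q_def by (rule card_squared_le_collisions) (use assms in auto)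
  then have "((real (card B))\<^sup>2)\<^sup>2 \<le> (real (card V) * real (card Q))\<^sup>2"
    by (rule power_mono) simp
  also have "\<dots> = (real (card V))\<^sup>2 * (real (card Q))\<^sup>2" by (rule power_mult_distrib)
  also have "(real (card Q))\<^sup>2 \<le> real (card D) * real (card (collisions ?f Q))"
    by (rule card_squared_le_collisions[OF fQ assms(4)]) (use sums in \<open>auto simp: Q_def collisions_def\<close>)
  also have "\<dots> \<le> real (card D) * real (additive_energy B)"
    using le by (intro mult_left_mono) auto
  finally show ?thesis by (simp add: mult_left_mono)
qed

text \<open>With progressions of length \<open>M\<close> in place of \<open>N\<^sup>2\<close>, the energies are of order \<open>M ^ 3 * N\<close> (additive)
and \<open>M\<^sup>2 * N ^ 3\<close> (multiplicative); \<open>M = N\<^sup>2\<close> balances them.\<close>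

definition dyadic_grid :: "nat \<Rightarrow> real set" where
  "dyadic_grid N = (\<lambda>(j, m). real ((2 * m + 1) * 2 ^ j)) ` ({..<N} \<times> {..<N\<^sup>2})"

lemma odd_times_power_inj:
  assumes "(2 * m + 1) * 2 ^ j = (2 * m' + 1) * 2 ^ j'"
  shows "j = j' \<and> m = (m'::nat)"
proof -
  have le: "j' \<le> j" if "(2 * m + 1) * 2 ^ j = (2 * m' + 1) * 2 ^ j'" for j j' m m' :: nat
  proof (rule ccontr)
    assume "\<not> j' \<le> j"
    then obtain d where d: "j' = j + Suc d" using less_imp_Suc_add[of j j'] by auto
    have "(2 * m + 1) * 2 ^ j = ((2 * m' + 1) * 2 ^ Suc d) * 2 ^ j"
      unfolding that d by (simp add: power_add algebra_simps)
    then have "2 * m + 1 = (2 * m' + 1) * 2 ^ Suc d"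
      unfolding mult_cancel2 by simp
    then have "2 * m + 1 = 2 * ((2 * m' + 1) * 2 ^ d)" by simp
    then have "even (2 * m + 1)" by (metis dvd_triv_left)
    then show False by simp
  qed
  have "j = j'" using le[OF assms] le[OF assms[symmetric]] by simp
  with assms show ?thesis by simp
qed

lemma inj_on_dyadic: "inj_on (\<lambda>(j, m). real ((2 * m + 1) * 2 ^ j)) X"
proof (rule inj_onI, clarify)
  fix j m j' m' :: nat
  assume "real ((2 * m + 1) * 2 ^ j) = real ((2 * m' + 1) * 2 ^ j')"
  then show "j = j' \<and> m = m'" unfolding of_nat_eq_iff by (rule odd_times_power_inj)
qed

lemma finite_dyadic_grid: "finite (dyadic_grid N)"
  by (simp add: dyadic_grid_def)

lemma card_dyadic_grid: "card (dyadic_grid N) = N ^ 3"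
  unfolding dyadic_grid_def
  by (subst card_image[OF inj_on_dyadic])
    (simp add: card_cartesian_product power2_eq_square power3_eq_cube)

lemma dyadic_grid_multiplicative:
  assumes C: "C \<subseteq> dyadic_grid N"
  shows "real (card C) ^ 4 \<le> 4 * real N ^ 5 * multiplicative_energy C"
proof -
  define D where "D = (\<lambda>(j, m). real ((2 * m + 1) * 2 ^ j)) ` ({..<2 * N} \<times> {..<2 * N ^ 4})"
  have fD: "finite D" by (simp add: D_def)
  have "a * b \<in> D" if ab: "a \<in> C" "b \<in> C" for a b
  proof -
    obtain j m where a: "j < N" "m < N\<^sup>2" "a = real ((2 * m + 1) * 2 ^ j)"
      using ab C by (auto simp: dyadic_grid_def)
    obtain j' m' where b: "j' < N" "m' < N\<^sup>2" "b = real ((2 * m' + 1) * 2 ^ j')"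
      using ab C by (auto simp: dyadic_grid_def)
    let ?k = "2 * m * m' + m + m'"
    have "(m + 1) * (m' + 1) \<le> N\<^sup>2 * N\<^sup>2" using a b by (intro mult_le_mono) auto
    then have "?k < 2 * N ^ 4" by (simp add: algebra_simps flip: power_add)
    moreover have "a * b = real ((2 * ?k + 1) * 2 ^ (j + j'))"
      using a b by (simp add: algebra_simps power_add)
    ultimately show ?thesis unfolding D_def using a b
      by (intro image_eqI[of _ _ "(j + j', ?k)"]) auto
  qed
  then have "real (card C) ^ 4 \<le> real (card D) * multiplicative_energy C"
    using fD finite_subset[OF C finite_dyadic_grid] by (intro multiplicative_energy_lower) auto
  also have "\<dots> \<le> real (4 * N ^ 5) * multiplicative_energy C"
  proof (intro mult_right_mono)
    have "card D \<le> card ({..<2 * N} \<times> {..<2 * N ^ 4})"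
      unfolding D_def by (rule card_image_le) simp
    also have "\<dots> = 4 * N ^ 5" by (simp add: card_cartesian_product eval_nat_numeral algebra_simps)
    finally show "real (card D) \<le> real (4 * N ^ 5)" by (simp only: of_nat_le_iff)
  qed simp
  finally show ?thesis by simp
qed

text \<open>The classes are the arithmetic progressions with fixed power of two. Their sums have the form
\<open>(2 * k + 2) * 2 ^ j\<close> with \<open>k < 2 * N\<^sup>2\<close>.\<close>

lemma dyadic_grid_additive:
  assumes B: "B \<subseteq> dyadic_grid N"
  shows "real (card B) ^ 4 \<le> 2 * real N ^ 5 * additive_energy B"
proof -
  let ?\<phi> = "\<lambda>(j, m). real ((2 * m + 1) * 2 ^ j)"
  \<comment> \<open>The exponent of the power of two in \<open>b\<close>.\<close>
  define v where "v b = fst (inv_into UNIV ?\<phi> b)" for b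
  have v: "v (real ((2 * m + 1) * 2 ^ j)) = j" for j m
    using inv_into_f_f[OF inj_on_dyadic[of UNIV] UNIV_I, of "(j, m)"] by (simp add: v_def)
  define D where "D = (\<lambda>(j, m). real ((2 * m + 2) * 2 ^ j)) ` ({..<N} \<times> {..<2 * N\<^sup>2})"
  have fD: "finite D" by (simp add: D_def)
  have sums: "a + b \<in> D" if ab: "a \<in> B" "b \<in> B" "v a = v b" for a b
  proof -
    obtain j m where a: "j < N" "m < N\<^sup>2" "a = real ((2 * m + 1) * 2 ^ j)"
      using ab B by (auto simp: dyadic_grid_def)
    obtain j' m' where b: "j' < N" "m' < N\<^sup>2" "b = real ((2 * m' + 1) * 2 ^ j')"
      using ab B by (auto simp: dyadic_grid_def)
    have "j' = j" using ab(3) unfolding a(3) b(3) v by simp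
    then have "a + b = real ((2 * (m + m') + 2) * 2 ^ j)"
      using a b by (simp add: algebra_simps)
    then show ?thesis unfolding D_def using a b
      by (intro image_eqI[of _ _ "(j, m + m')"]) auto
  qed
  have vB: "v ` B \<subseteq> {..<N}"
  proof
    fix i assume "i \<in> v ` B"
    then obtain j m where "j < N" "i = v (real ((2 * m + 1) * 2 ^ j))"
      using B by (auto simp: dyadic_grid_def)
    then show "i \<in> {..<N}" unfolding v by simp
  qed
  have "real (card B) ^ 4 \<le> (real (card {..<N}))\<^sup>2 * (real (card D) * additive_energy B)"
    by (rule additive_energy_lower[OF finite_subset[OF B finite_dyadic_grid] _ vB fD sums]) auto
  also have "\<dots> \<le> (real (card {..<N}))\<^sup>2 * (real (2 * N ^ 3) * additive_energy B)"
  proof (intro mult_left_mono mult_right_mono)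
    have "card D \<le> card ({..<N} \<times> {..<2 * N\<^sup>2})"
      unfolding D_def by (rule card_image_le) simp
    also have "\<dots> = 2 * N ^ 3" by (simp add: card_cartesian_product eval_nat_numeral algebra_simps)
    finally show "real (card D) \<le> real (2 * N ^ 3)" by (simp only: of_nat_le_iff)
  qed auto
  finally show ?thesis by (simp add: eval_nat_numeral mult_ac)
qed

lemma dyadic_grid_energy:
  assumes "dyadic_grid N = B \<union> C" "N > 0"
  shows "real N ^ 7 / 64 \<le> real (max (additive_energy B) (multiplicative_energy C))"
proof -
  \<comment> \<open>The additive bound is relaxed to the constant of the multiplicative one, so that one
    computation serves both parts.\<close>
  have large: "real N ^ 7 / 64 \<le> e" if "real N ^ 3 / 2 \<le> c" "c ^ 4 \<le> 4 * real N ^ 5 * e" for c e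
  proof -
    have "(real N ^ 3 / 2) ^ 4 \<le> c ^ 4" by (rule power_mono[OF that(1)]) simp
    then have "(real N ^ 3 / 2) ^ 4 \<le> 4 * real N ^ 5 * e" using that(2) by linarith
    moreover have "(real N ^ 3 / 2) ^ 4 = 4 * real N ^ 5 * (real N ^ 7 / 64)"
      by (simp add: power_divide flip: power_mult power_add)
    ultimately have "4 * real N ^ 5 * (real N ^ 7 / 64) \<le> 4 * real N ^ 5 * e" by linarith
    then show ?thesis using assms(2) by (simp only: mult_le_cancel_left) simp
  qed
  have "N ^ 3 \<le> card B + card C"
    using card_Un_le[of B C] assms(1) card_dyadic_grid[of N] by simp
  then have "real N ^ 3 \<le> real (card B) + real (card C)"
    by (simp flip: of_nat_power of_nat_add)
  then consider "real N ^ 3 / 2 \<le> card B" | "real N ^ 3 / 2 \<le> card C" by linarith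
  then show ?thesis
  proof cases
    case 1
    have "real (card B) ^ 4 \<le> 2 * real N ^ 5 * additive_energy B"
      by (rule dyadic_grid_additive) (use assms in auto)
    also have "\<dots> \<le> 4 * real N ^ 5 * additive_energy B" by (intro mult_right_mono) auto
    finally show ?thesis using large[OF 1] by fastforce
  next
    case 2
    have "real (card C) ^ 4 \<le> 4 * real N ^ 5 * multiplicative_energy C"
      by (rule dyadic_grid_multiplicative) (use assms in auto)
    then show ?thesis using large[OF 2] by fastforce
  qed
qed

lemma permissible_exponent_ge:
  assumes "permissible_exponent \<beta>"
  shows "1 / 3 \<le> \<beta>"
proof (rule ccontr)
  assume "\<not> 1 / 3 \<le> \<beta>"
  define \<epsilon> where "\<epsilon> = (1 / 3 - \<beta>) / 2"
  have \<epsilon>: "\<epsilon> > 0" using \<open>\<not> 1 / 3 \<le> \<beta>\<close> by (simp add: \<epsilon>_def)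
  from assms[unfolded permissible_exponent_def, rule_format, OF \<epsilon>]
  obtain N0 where N0: "\<forall>A::real set. finite A \<and> card A \<ge> N0 \<longrightarrow>
        (\<exists>B C. A = B \<union> C \<and> B \<inter> C = {} \<and>
           real (max (additive_energy B) (multiplicative_energy C))
             \<le> real (card A) powr (2 + \<beta> + \<epsilon>))"
    by (elim exE) (rule that)
  have "eventually (\<lambda>N::nat. real N powr (7 - 3 * \<epsilon>) < real N ^ 7 / 64) at_top"
    using \<epsilon> by real_asymp
  moreover have "eventually (\<lambda>N. N > 0 \<and> N0 \<le> N) at_top"
    using eventually_gt_at_top[of "0::nat"] eventually_ge_at_top[of N0] by eventually_elim auto
  ultimately have "eventually (\<lambda>N. N > 0 \<and> N0 \<le> N \<and> real N powr (7 - 3 * \<epsilon>) < real N ^ 7 / 64) at_top"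
    by eventually_elim auto
  then obtain N where N: "N > 0" "N0 \<le> N" "real N powr (7 - 3 * \<epsilon>) < real N ^ 7 / 64"
    using eventually_happens'[OF sequentially_bot] by blast
  have "N \<le> N ^ 3" using N(1) by (simp add: self_le_power)
  then obtain B C where BC: "dyadic_grid N = B \<union> C"
    "real (max (additive_energy B) (multiplicative_energy C)) \<le> real (N ^ 3) powr (2 + \<beta> + \<epsilon>)"
    using N0[rule_format, of "dyadic_grid N"] N(2) finite_dyadic_grid unfolding card_dyadic_grid
    by (metis le_trans)
  have "real (N ^ 3) powr (2 + \<beta> + \<epsilon>) = real N powr (7 - 3 * \<epsilon>)"
  proof -
    have "real (N ^ 3) = real N powr 3" using N(1) by (simp add: powr_numeral)
    moreover have "3 * (2 + \<beta> + \<epsilon>) = 7 - 3 * \<epsilon>" by (simp add: \<epsilon>_def field_simps)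
    ultimately show ?thesis by (simp only: powr_powr)
  qed
  with dyadic_grid_energy[OF BC(1) N(1)] BC(2) N(3) show False by linarith
qed

section \<open>The bounds for the infimum\<close>

theorem theorem1p2: "ereal (1/3) \<le> kappa \<and> kappa \<le> ereal (31/33)"
proof
  show "ereal (1/3) \<le> kappa"
    unfolding kappa_def
  proof (rule INF_greatest)
    fix \<beta> assume "\<beta> \<in> {\<beta>. permissible_exponent \<beta>}"
    then have "1 / 3 \<le> \<beta>" using permissible_exponent_ge by blast
    then show "ereal (1/3) \<le> ereal \<beta>" by (simp only: ereal_less_eq)
  qed
  show "kappa \<le> ereal (31/33)"
    unfolding kappa_def by (rule INF_lower) (simp add: permissible_exponent_31_33)
qed

end
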